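(* Let $G$ be a graph in $\varepsilon_1$. Then every block of $G$ is a cycle $C_n$ with $n\equiv 1 \pmod 4$.
   Context: All graphs are finite, simple, undirected and connected. An Euler graph is a connected graph in which every vertex has even degree. $\varepsilon_1$ denotes the class of Euler graphs $G$ such that every cycle of $G$ has length $n\equiv 1 \pmod 4$. A block is a maximal connected subgraph without cut vertices.
   Formalization: The one-vertex graph is excluded by requiring at least two vertices: it is connected, has even degree 0 and no cycles, so it lies in the class, but its only block is a single vertex, which is not a cycle. *)

theory Defs
  imports "Graph_Theory.Graph_Theory"
begin

text \<open>
  Finite simple undirected graphs are modelled by the locale predicate \<^const>\<open>graph\<close>: finite
  symmetric digraphs without loops and parallel arcs, where an edge \<open>uv\<close> is the pair of opposite
  arcs \<open>(u,v)\<close> and \<open>(v,u)\<close>. Hence the degree of a vertex is its out-degree.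
\<close>

definition euler_graph :: "('a,'b) pre_digraph \<Rightarrow> bool" where
  "euler_graph G \<longleftrightarrow> graph G \<and> connected G \<and> (\<forall>v \<in> verts G. even (out_degree G v))"

text \<open>
  \<^const>\<open>pre_digraph.cycle\<close> also accepts the closed walk \<open>u, v, u\<close> along a single edge; the length
  condition excludes exactly these.
\<close>
definition undirected_cycle :: "('a,'b) pre_digraph \<Rightarrow> 'b awalk \<Rightarrow> bool" where
  "undirected_cycle G p \<longleftrightarrow> pre_digraph.cycle G p \<and> 3 \<le> length p"

definition epsilon1 :: "('a,'b) pre_digraph set" where
  "epsilon1 = {G. euler_graph G \<and> (\<forall>p. undirected_cycle G p \<longrightarrow> length p mod 4 = 1)}"

text \<open>
  A cut vertex separates two other vertices of the same component. Stating this as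
  \<open>\<not> connected (G - v)\<close> would be wrong for the one-vertex graph, since the null graph is not
  \<^const>\<open>connected\<close>.
\<close>
definition cut_vertex :: "('a,'b) pre_digraph \<Rightarrow> 'a \<Rightarrow> bool" where
  "cut_vertex G v \<longleftrightarrow> v \<in> verts G \<and>
     (\<exists>x \<in> verts G - {v}. \<exists>y \<in> verts G - {v}.
        x \<rightarrow>\<^sup>*\<^bsub>G\<^esub> y \<and> \<not> x \<rightarrow>\<^sup>*\<^bsub>pre_digraph.del_vert G v\<^esub> y)"

text \<open>
  \<open>graph H\<close> restricts the library's subgraphs, which may contain only one of two opposite arcs,
  to undirected subgraphs.
\<close>
definition block :: "('a,'b) pre_digraph \<Rightarrow> ('a,'b) pre_digraph \<Rightarrow> bool" where
  "block G B \<longleftrightarrow>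
     pre_digraph.max_subgraph G (\<lambda>H. graph H \<and> connected H \<and> \<not> (\<exists>v. cut_vertex H v)) B"

definition cycle_graph :: "nat \<Rightarrow> ('a,'b) pre_digraph \<Rightarrow> bool" where
  "cycle_graph n G \<longleftrightarrow> graph G \<and> 3 \<le> n \<and>
     (\<exists>vs. distinct vs \<and> length vs = n \<and> set vs = verts G \<and>
        arcs_ends G = {(u, v). \<exists>i < n. {u, v} = {vs ! i, vs ! (Suc i mod n)}})"

end

theory Submission
  imports Defs
begin

text \<open>
  If a connected graph without cut vertices contains a cycle \<open>C\<close> and an edge outside \<open>C\<close>, then \<open>C\<close>
  has an ear. The three paths between the ends of the ear form three cycles whose lengths add up to
  twice the number of edges involved, so the three lengths cannot all be odd. Hence a block that
  contains a cycle is that cycle. A block without a cycle has at most one edge, but by the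
  handshake lemma every edge of an Euler graph lies on a cycle, and the subgraph induced on such a
  cycle would be a larger subgraph without cut vertices.
\<close>

section \<open>Cycles of a relation\<close>

text \<open>Vertex lists instead of arc lists let cycles be cut, reversed and rejoined by list
  operations. Appending the head supplies the closing edge; the length bound excludes an edge walked
  back and forth.\<close>

definition vertex_cycle :: "'a rel \<Rightarrow> 'a list \<Rightarrow> bool" where
  "vertex_cycle E vs \<longleftrightarrow>
     distinct vs \<and> 3 \<le> length vs \<and> successively (\<lambda>x y. (x, y) \<in> E) (vs @ [hd vs])"

lemma vertex_cycle_mono: "vertex_cycle E vs \<Longrightarrow> E \<subseteq> F \<Longrightarrow> vertex_cycle F vs"
  unfolding vertex_cycle_def by (blast intro: successively_mono)

lemma vertex_cycle_rotate1:
  assumes "vertex_cycle E vs"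
  shows "vertex_cycle E (rotate1 vs)"
proof (cases vs)
  case (Cons x xs)
  then show ?thesis
    using assms by (auto simp: vertex_cycle_def successively_append_iff successively_Cons)
qed (use assms in simp)

lemma vertex_cycle_rotate: "vertex_cycle E vs \<Longrightarrow> vertex_cycle E (rotate m vs)"
  by (induction m) (auto simp: vertex_cycle_rotate1)

lemma vertex_cycle_nth:
  assumes "vertex_cycle E vs" "i < length vs"
  shows "(vs ! i, vs ! (Suc i mod length vs)) \<in> E"
proof -
  have "vs \<noteq> []" using assms by auto
  have "((vs @ [hd vs]) ! i, (vs @ [hd vs]) ! Suc i) \<in> E"
    using assms unfolding vertex_cycle_def successively_conv_nth by simp
  moreover have "(vs @ [hd vs]) ! Suc i = vs ! (Suc i mod length vs)"
    using assms(2) \<open>vs \<noteq> []\<close> by (cases "Suc i = length vs") (auto simp: nth_append hd_conv_nth)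
  ultimately show ?thesis
    using assms(2) by (simp add: nth_append)
qed

text \<open>Every entry is reachable from the head, and symmetry turns one of the two walks
  around.\<close>

lemma successively_in_rtrancl:
  assumes "successively (\<lambda>x y. (x, y) \<in> R) xs" "sym R" "a \<in> set xs" "b \<in> set xs"
  shows "(a, b) \<in> R\<^sup>*"
proof -
  have from_hd: "\<forall>z \<in> set xs. (hd xs, z) \<in> R\<^sup>*" if "successively (\<lambda>x y. (x, y) \<in> R) xs" for xs
    using that
  proof (induction xs)
    case (Cons x xs)
    then show ?case
      by (cases xs) (auto intro: converse_rtrancl_into_rtrancl)
  qed simp
  have "(hd xs, a) \<in> R\<^sup>*" "(hd xs, b) \<in> R\<^sup>*"
    using from_hd[OF assms(1)] assms(3,4) by auto
  then show ?thesis
    using sym_rtrancl[OF assms(2)] by (meson rtrancl_trans symD)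
qed

text \<open>Turns reachability into a simple path that stops at its first vertex in
  \<open>S\<close>: with a cycle for \<open>S\<close> this yields an ear, with a singleton just a
  simple path. The end \<open>s\<close> is kept out of \<open>W\<close>, so \<open>W\<close> is
  empty exactly when \<open>w\<close> already lies in \<open>S\<close>.\<close>

lemma rtrancl_first_hit:
  assumes "(w, x) \<in> R\<^sup>*" "x \<in> S"
  obtains W s where "s \<in> S" "set W \<inter> S = {}" "distinct W"
    "successively (\<lambda>x y. (x, y) \<in> R) (W @ [s])" "hd (W @ [s]) = w"
proof -
  let ?P = "\<lambda>w W s. s \<in> S \<and> set W \<inter> S = {} \<and> distinct W
    \<and> successively (\<lambda>x y. (x, y) \<in> R) (W @ [s]) \<and> hd (W @ [s]) = w"
  have "\<exists>W s. ?P w W s"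
    using assms(1)
  proof (induction rule: converse_rtrancl_induct)
    case base
    have "?P x [] x" using assms(2) by simp
    then show ?case by blast
  next
    case (step y z)
    then obtain W s where W: "?P z W s" by blast
    consider "y \<in> S" | "y \<notin> S" "y \<in> set W" | "y \<notin> S" "y \<notin> set W" by blast
    then show ?case
    proof cases
      case 1
      then have "?P y [] y" by simp
      then show ?thesis by blast
    next
      case 2
      \<comment> \<open>Restarting at the occurrence of \<open>y\<close> in \<open>W\<close> cuts
        out the loop that prepending \<open>y\<close> would create.\<close>
      then obtain U V where "W = U @ y # V" by (meson split_list)
      then have "?P y (y # V) s" using W by (auto simp: successively_append_iff)
      then show ?thesis by blast
    next
      case 3
      then have "?P y (y # W) s" using W step(1) by (auto simp: successively_Cons)
      then show ?thesis by blast
    qed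
  qed
  then show ?thesis using that by blast
qed

text \<open>The core of the handshake lemma: pairs of a symmetric irreflexive relation can be
  removed two at a time, each with its opposite.\<close>

lemma even_card_sym_irrefl:
  assumes "finite E" "sym E" "irrefl E"
  shows "even (card E)"
  using assms
proof (induction "card E" arbitrary: E rule: less_induct)
  case less
  show ?case
  proof (cases "E = {}")
    case False
    then obtain x y where xy: "(x, y) \<in> E" by auto
    then have yx: "(y, x) \<in> E" "x \<noteq> y" using less.prems by (auto dest: symD irreflD)
    let ?F = "E - {(x, y), (y, x)}"
    have card: "card E = card ?F + 2"
    proof -
      have "card {(x, y), (y, x)} = 2" using yx by auto
      moreover have "{(x, y), (y, x)} \<subseteq> E" using xy yx by auto
      ultimately show ?thesis
        using card_Diff_subset[of "{(x, y), (y, x)}" E] card_mono[OF less.prems(1)]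
        by (metis finite_subset[OF _ less.prems(1)] le_add_diff_inverse2)
    qed
    have "even (card ?F)"
      using less.prems card by (intro less.hyps) (auto simp: sym_def irrefl_def)
    then show ?thesis using card by simp
  qed simp
qed

text \<open>An edge in a graph with even degrees is no bridge, so a path from \<open>y\<close> to
  \<open>x\<close> survives its removal and closes up to a cycle.\<close>

lemma edge_in_vertex_cycle:
  assumes "finite E" "sym E" "irrefl E" and even: "\<And>v. even (card (E `` {v}))"
    and xy: "(x, y) \<in> E"
  obtains C where "vertex_cycle E C" "x \<in> set C" "y \<in> set C"
proof -
  define R where "R = E - {(x, y), (y, x)}"
  have "x \<noteq> y" and yx: "(y, x) \<in> E" using assms by (auto dest: symD irreflD)
  have "sym R" using \<open>sym E\<close> by (auto simp: R_def sym_def)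
  have "(y, x) \<in> R\<^sup>*"
  proof (rule ccontr)
    assume contr: "(y, x) \<notin> R\<^sup>*"
    \<comment> \<open>The edges inside the component of \<open>y\<close> after removing \<open>xy\<close> violate the handshake lemma.\<close>
    define S where "S = R\<^sup>* `` {y}"
    have closed: "b \<in> S" if "a \<in> S" "(a, b) \<in> R" for a b
      using that by (auto simp: S_def intro: rtrancl_into_rtrancl)
    have S: "y \<in> S" "x \<notin> S" using contr by (auto simp: S_def)
    have "S \<subseteq> insert y (Range R)" by (auto simp: S_def elim: rtranclE)
    moreover have "finite (Range R)" using \<open>finite E\<close> by (simp add: R_def finite_Range)
    ultimately have "finite S" by (meson finite.insertI finite_subset)
    have finE: "finite (E `` {v})" for v
      using \<open>finite E\<close> by (rule finite_Image)
    \<comment> \<open>As \<open>x\<close> is outside \<open>S\<close>, the removed edge affects only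
      the neighbourhood of \<open>y\<close> within \<open>S\<close>.\<close>
    have R_Image: "R `` {v} = (if v = y then E `` {v} - {x} else E `` {v})" if "v \<in> S" for v
      using that S by (auto simp: R_def)
    have "card (E `` {y}) = Suc (card (R `` {y}))"
      using R_Image[OF S(1)] yx card.remove[OF finE, of x y] by simp
    then have odd_y: "odd (card (R `` {y}))" using even[of y] by auto
    have "(\<Sum>v\<in>S. card (R `` {v})) = card (R `` {y}) + (\<Sum>v\<in>S - {y}. card (R `` {v}))"
      using \<open>finite S\<close> S(1) by (rule sum.remove)
    moreover have "even (\<Sum>v\<in>S - {y}. card (R `` {v}))"
      by (intro dvd_sum) (auto simp: R_Image even)
    ultimately have "odd (\<Sum>v\<in>S. card (R `` {v}))" using odd_y by simp
    \<comment> \<open>The degree sum counts the pairs of \<open>R\<close> starting in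
      \<open>S\<close>. By \<open>closed\<close> they also end in \<open>S\<close>, hence they form
      a symmetric relation.\<close>
    moreover have "(\<Sum>v\<in>S. card (R `` {v})) = card (SIGMA v:S. R `` {v})"
      using \<open>finite S\<close> \<open>finite E\<close> by (simp add: R_def finite_Image)
    moreover have "even (card (SIGMA v:S. R `` {v}))"
    proof (rule even_card_sym_irrefl)
      show "finite (SIGMA v:S. R `` {v})"
        using \<open>finite S\<close> \<open>finite E\<close> by (auto simp: R_def intro!: finite_Image)
      show "sym (SIGMA v:S. R `` {v})"
        using \<open>sym R\<close> closed by (auto simp: sym_def)
      show "irrefl (SIGMA v:S. R `` {v})"
        using \<open>irrefl E\<close> by (auto simp: irrefl_def R_def)
    qed
    ultimately show False by simp
  qed
  then obtain W s where W: "s \<in> {x}" "set W \<inter> {x} = {}" "distinct W"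
    "successively (\<lambda>x y. (x, y) \<in> R) (W @ [s])" "hd (W @ [s]) = y"
    using singletonI by (rule rtrancl_first_hit)
  have "W \<noteq> []" using W \<open>x \<noteq> y\<close> by auto
  \<comment> \<open>This secures length 3: the path must not be the removed edge itself.\<close>
  moreover have "W \<noteq> [y]"
  proof
    assume "W = [y]"
    then have "(y, x) \<in> R" using W(1,4) by simp
    then show False by (simp add: R_def)
  qed
  ultimately obtain b W' where W': "W = y # b # W'"
    using W by (cases W rule: remdups_adj.cases) auto
  have "successively (\<lambda>x y. (x, y) \<in> E) (W @ [x])"
    using W by (auto simp: R_def elim: successively_mono)
  then have "successively (\<lambda>x y. (x, y) \<in> E) ((W @ [x]) @ [y])"
    using xy by (subst successively_append_iff) simp
  then have "vertex_cycle E (W @ [x])"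
    using W W' by (auto simp: vertex_cycle_def)
  then show ?thesis using W' by (intro that) auto
qed

section \<open>Ears\<close>

text \<open>The ear from \<open>c\<close> through \<open>W\<close> to \<open>c'\<close> has the single edge \<open>c c'\<close> if \<open>W\<close> is empty.\<close>

lemma ear_even_cycle:
  assumes "sym E" and C: "vertex_cycle E (c # A @ c' # D)"
    and W: "distinct W" "set W \<inter> set (c # A @ c' # D) = {}"
      "successively (\<lambda>x y. (x, y) \<in> E) (c # W @ [c'])"
    and chord: "W \<noteq> [] \<or> A \<noteq> [] \<and> D \<noteq> []"
  shows "\<exists>vs. vertex_cycle E vs \<and> even (length vs)"
proof (rule ccontr)
  assume contr: "\<not> ?thesis"
  have swap: "successively (\<lambda>x y. (y, x) \<in> E) = successively (\<lambda>x y. (x, y) \<in> E)"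
    by (intro arg_cong[where f = successively] ext) (use \<open>sym E\<close> in \<open>blast dest: symD\<close>)
  have A: "successively (\<lambda>x y. (x, y) \<in> E) (c # A @ [c'])"
    and D: "successively (\<lambda>x y. (x, y) \<in> E) (c' # D @ [c])"
    using C by (auto simp: vertex_cycle_def successively_append_iff successively_Cons hd_append
        split: if_splits)
  have W': "successively (\<lambda>x y. (x, y) \<in> E) (c' # rev W @ [c])"
  proof -
    have "successively (\<lambda>x y. (x, y) \<in> E) (rev (c # W @ [c']))"
      unfolding successively_rev swap by (rule W(3))
    then show ?thesis by simp
  qed
  \<comment> \<open>Two paths with common ends and disjoint interiors form a cycle; a single inner
    vertex suffices for length 3.\<close>
  have join: "vertex_cycle E (x # P @ y # Q)"
    if "successively (\<lambda>x y. (x, y) \<in> E) (x # P @ [y])"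
      "successively (\<lambda>x y. (x, y) \<in> E) (y # Q @ [x])"
      "distinct (x # P @ y # Q)" "P \<noteq> [] \<or> Q \<noteq> []" for x y P Q
  proof -
    have "3 \<le> length (x # P @ y # Q)" using that(4) by (cases P; cases Q) auto
    then show ?thesis
      using that
      by (auto simp: vertex_cycle_def successively_append_iff successively_Cons hd_append)
  qed
  have "distinct (c # A @ c' # D)" using C by (simp add: vertex_cycle_def)
  \<comment> \<open>The ear is joined with each of the two arcs of the cycle; \<open>chord\<close>
    provides an inner vertex in both cases.\<close>
  then have "vertex_cycle E (c # A @ c' # rev W)" "vertex_cycle E (c # W @ c' # D)"
    using A D W W' chord by (auto intro!: join)
  with C contr have "odd (length (c # A @ c' # D))" "odd (length (c # A @ c' # rev W))"
    "odd (length (c # W @ c' # D))"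
    by blast+
  \<comment> \<open>The three lengths add up to
    \<open>2 * (length A + length D + length W) + 6\<close>, which is even.\<close>
  then show False by simp
qed

text \<open>The hypothesis \<open>conn\<close> says locally that \<open>c\<close> is not a cut
  vertex. It leads from \<open>w\<close> back to the cycle while avoiding \<open>c\<close>, so a
  third edge at \<open>c\<close> would start an ear.\<close>

lemma edge_at_odd_cycle:
  assumes "sym E" "irrefl E" and C: "vertex_cycle E (c # T)"
    and odd: "\<And>vs. vertex_cycle E vs \<Longrightarrow> odd (length vs)"
    and conn: "\<And>x y. (c, x) \<in> E \<Longrightarrow> (c, y) \<in> E \<Longrightarrow>
      (x, y) \<in> {(a, b) \<in> E. a \<noteq> c \<and> b \<noteq> c}\<^sup>*"
    and cw: "(c, w) \<in> E"
  shows "w = hd T \<or> w = last T"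
proof (rule ccontr)
  assume contr: "\<not> ?thesis"
  let ?R = "{(a, b) \<in> E. a \<noteq> c \<and> b \<noteq> c}"
  have "T \<noteq> []" using C by (auto simp: vertex_cycle_def)
  then have "(c, hd T) \<in> E" using C by (auto simp: vertex_cycle_def successively_Cons)
  then have "(w, hd T) \<in> ?R\<^sup>*" using cw conn by blast
  moreover have "hd T \<in> set T" using \<open>T \<noteq> []\<close> by simp
  \<comment> \<open>\<open>hd T\<close> only guarantees that the cycle is reached; the ear ends at
    the first vertex \<open>c'\<close> of \<open>T\<close> that is met.\<close>
  ultimately obtain W c' where W: "c' \<in> set T" "set W \<inter> set T = {}" "distinct W"
    "successively (\<lambda>x y. (x, y) \<in> ?R) (W @ [c'])" "hd (W @ [c']) = w"
    by (rule rtrancl_first_hit)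
  obtain A D where T: "T = A @ c' # D" using W(1) by (meson split_list)
  have "w \<noteq> c" using cw \<open>irrefl E\<close> by (auto dest: irreflD)
  have "c \<notin> set W"
  proof
    assume "c \<in> set W"
    \<comment> \<open>Every member of \<open>W\<close> has a successor on the path, but no pair of
      \<open>?R\<close> starts at \<open>c\<close>.\<close>
    then obtain U V where "W = U @ c # V" by (meson split_list)
    then show False using W(4) by (auto simp: successively_append_iff successively_Cons)
  qed
  moreover have "successively (\<lambda>x y. (x, y) \<in> E) (c # W @ [c'])"
  proof -
    have "successively (\<lambda>x y. (x, y) \<in> E) (W @ [c'])"
      by (rule successively_mono[OF W(4)]) auto
    then show ?thesis using W(5) cw by (simp add: successively_Cons)
  qed
  \<comment> \<open>If \<open>W\<close> is empty, then \<open>w = c'\<close>, and \<open>w\<close>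
    being neither first nor last in \<open>T\<close> makes both arcs nonempty.\<close>
  moreover have "W \<noteq> [] \<or> A \<noteq> [] \<and> D \<noteq> []"
  proof (rule ccontr)
    assume "\<not> ?thesis"
    then have "w = c'" "A = [] \<or> D = []" using W(5) by auto
    then show False using contr T by auto
  qed
  ultimately show False
    using ear_even_cycle[OF \<open>sym E\<close>, of c A c' D W] C W T odd by auto
qed

text \<open>Rotating \<open>c\<close> to the front reduces this to \<open>edge_at_odd_cycle\<close>;
  \<open>hd T\<close> and \<open>last T\<close> then are the successor and the predecessor of
  \<open>c\<close> on \<open>C\<close>.\<close>

lemma odd_cycle_edges:
  assumes "sym E" "irrefl E" and C: "vertex_cycle E C"
    and odd: "\<And>vs. vertex_cycle E vs \<Longrightarrow> odd (length vs)"
    and conn: "\<And>c x y. (c, x) \<in> E \<Longrightarrow> (c, y) \<in> E \<Longrightarrow>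
      (x, y) \<in> {(a, b) \<in> E. a \<noteq> c \<and> b \<noteq> c}\<^sup>*"
    and c: "c \<in> set C" "(c, w) \<in> E"
  shows "\<exists>i < length C. {c, w} = {C ! i, C ! (Suc i mod length C)}"
proof -
  let ?n = "length C"
  obtain i where i: "i < ?n" "c = C ! i" using c(1) by (auto simp: in_set_conv_nth)
  have n: "3 \<le> ?n" using C by (simp add: vertex_cycle_def)
  define C' where "C' = rotate i C"
  have nth: "C' ! k = C ! ((i + k) mod ?n)" if "k < ?n" for k
    using that by (simp add: C'_def nth_rotate)
  have len: "length C' = ?n" by (simp add: C'_def)
  then obtain d T where C': "C' = d # T" using n by (cases C') auto
  have "C \<noteq> []" using n by auto
  then have d: "d = c" using nth[of 0] i C' by simp
  have "vertex_cycle E (c # T)" using C vertex_cycle_rotate[of E C i] C' d by (simp add: C'_def)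
  then have "w = hd T \<or> w = last T"
    by (rule edge_at_odd_cycle[OF \<open>sym E\<close> \<open>irrefl E\<close> _ odd conn c(2)])
  moreover have "T \<noteq> []" using len C' n by auto
  moreover have "hd T = C ! (Suc i mod ?n)"
    using nth[of 1] C' n \<open>T \<noteq> []\<close> by (simp add: hd_conv_nth)
  moreover have "last T = C ! ((i + (?n - 1)) mod ?n)"
  proof -
    have "last T = last C'" using C' \<open>T \<noteq> []\<close> by simp
    also have "\<dots> = C' ! (?n - 1)" using C' len by (metis last_conv_nth list.distinct(1))
    finally show ?thesis using nth[of "?n - 1"] n by simp
  qed
  \<comment> \<open>The edge to the predecessor is found under the predecessor's index. Writing it
    as \<open>i + (?n - 1)\<close> modulo \<open>?n\<close> also covers
    \<open>i = 0\<close>.\<close>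
  moreover have "Suc ((i + (?n - 1)) mod ?n) mod ?n = i"
  proof -
    have "Suc (i + (?n - 1)) = i + ?n" using n by linarith
    then show ?thesis using i(1) by (metis mod_Suc_eq mod_add_self2 mod_less)
  qed
  moreover have "(i + (?n - 1)) mod ?n < ?n" using n by (intro mod_less_divisor) linarith
  ultimately show ?thesis using i by (metis insert_commute)
qed

section \<open>Reachability in graphs\<close>

text \<open>The hypothesis concerns the reflexive case: \<open>(x, x)\<close> lies in the closure
  for every \<open>x\<close>, while \<open>x\<close> reaches itself in the graph only as a
  vertex.\<close>

lemma (in wf_digraph) reachable_iff_rtrancl:
  assumes "x \<in> verts G"
  shows "x \<rightarrow>\<^sup>* y \<longleftrightarrow> (x, y) \<in> (arcs_ends G)\<^sup>*"
proof
  assume "(x, y) \<in> (arcs_ends G)\<^sup>*"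
  then show "x \<rightarrow>\<^sup>* y"
    by induction (use assms in \<open>auto intro: reachable_adj_trans\<close>)
qed (rule reachable_rtranclI)

lemma arcs_ends_del_vert:
  "arcs_ends (pre_digraph.del_vert G v) = {(a, b) \<in> arcs_ends G. a \<noteq> v \<and> b \<noteq> v}"
  by (auto simp: arcs_ends_conv pre_digraph.del_vert_simps)

lemma arcs_ends_induce_subgraph:
  "arcs_ends (G \<restriction> S) = {(a, b) \<in> arcs_ends G. a \<in> S \<and> b \<in> S}"
  by (auto simp: arcs_ends_conv)

lemma (in wf_digraph) del_vert_reachable_iff:
  assumes "x \<in> verts G" "x \<noteq> v"
  shows "x \<rightarrow>\<^sup>*\<^bsub>del_vert v\<^esub> y \<longleftrightarrow> (x, y) \<in> {(a, b) \<in> arcs_ends G. a \<noteq> v \<and> b \<noteq> v}\<^sup>*"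
proof -
  interpret D: wf_digraph "del_vert v" by (rule wf_digraph_del_vert)
  show ?thesis
    using assms by (simp add: D.reachable_iff_rtrancl arcs_ends_del_vert pre_digraph.del_vert_simps)
qed

lemma (in graph) connected_iff_rtrancl:
  "connected G \<longleftrightarrow>
    verts G \<noteq> {} \<and> (\<forall>x \<in> verts G. \<forall>y \<in> verts G. (x, y) \<in> (arcs_ends G)\<^sup>*)"
  using reachable_mk_symmetric_eq[OF sym_arcs] reachable_iff_rtrancl
  by (auto simp: connected_def strongly_connected_def)

lemma (in graph) sym_arcs_ends: "sym (arcs_ends G)"
  using sym_arcs by (simp add: symmetric_def)

lemma (in graph) irrefl_arcs_ends: "irrefl (arcs_ends G)"
  using no_loops by (auto simp: irrefl_def arcs_ends_conv)

text \<open>Without parallel arcs \<open>head G\<close> is injective on the arcs leaving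
  \<open>v\<close>. This carries the Euler condition over to relations.\<close>

lemma (in graph) card_arcs_ends_Image: "card (arcs_ends G `` {v}) = out_degree G v"
proof -
  have "arcs_ends G `` {v} = head G ` out_arcs G v"
    by (auto simp: arcs_ends_conv out_arcs_def)
  moreover have "inj_on (head G) (out_arcs G v)"
    using no_multi_arcs by (auto simp: inj_on_def out_arcs_def arc_to_ends_def)
  ultimately show ?thesis by (simp add: out_degree_def card_image)
qed

lemma (in graph) graph_induce_subgraph:
  assumes "S \<subseteq> verts G"
  shows "graph (G \<restriction> S)"
proof -
  interpret H: digraph "G \<restriction> S" by (rule digraphI_induced) (rule induced_induce[OF assms])
  have "symmetric (G \<restriction> S)"
    using sym_arcs_ends by (auto simp: symmetric_def arcs_ends_induce_subgraph sym_def)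
  then show ?thesis by (rule H.graphI)
qed

lemma (in wf_digraph) vertex_cycle_subset_verts:
  assumes "vertex_cycle (arcs_ends G) C"
  shows "set C \<subseteq> verts G"
proof
  fix x assume "x \<in> set C"
  then obtain i where "i < length C" "x = C ! i" by (auto simp: in_set_conv_nth)
  then show "x \<in> verts G" using vertex_cycle_nth[OF assms] by (auto dest: adj_in_verts)
qed

section \<open>From vertex lists to closed walks of arcs\<close>

lemma (in wf_digraph) awalk_of_vertices:
  assumes "xs \<noteq> []" "hd xs \<in> verts G" "successively (\<lambda>x y. (x, y) \<in> arcs_ends G) xs"
  shows "\<exists>p. awalk (hd xs) p (last xs) \<and> awalk_verts (hd xs) p = xs"
  using assms
proof (induction xs rule: induct_list012)
  case (2 x)
  then have "awalk x [] x \<and> awalk_verts x [] = [x]" by (simp add: awalk_Nil_iff)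
  then show ?case by auto
next
  case (3 x y zs)
  then have xy: "(x, y) \<in> arcs_ends G" by simp
  then obtain e where e: "e \<in> arcs G" "tail G e = x" "head G e = y"
    by (auto simp: arcs_ends_conv)
  obtain p where "awalk y p (last (y # zs))" "awalk_verts y p = y # zs"
    using 3 xy by (auto dest: adj_in_verts)
  then have "awalk x (e # p) (last (y # zs)) \<and> awalk_verts x (e # p) = x # y # zs"
    using e by (simp add: awalk_Cons_iff)
  then show ?case by auto
qed simp

text \<open>Makes the length condition of \<open>epsilon1\<close> available for vertex lists. A walk
  has one vertex more than arcs, which offsets the repeated head.\<close>

lemma (in wf_digraph) undirected_cycle_of_vertex_cycle:
  assumes "vertex_cycle (arcs_ends G) C"
  shows "\<exists>p. undirected_cycle G p \<and> length p = length C"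
proof -
  obtain c T where C: "C = c # T" using assms by (cases C) (auto simp: vertex_cycle_def)
  obtain p where p: "awalk c p c" "awalk_verts c p = C @ [c]"
    using awalk_of_vertices[of "C @ [c]"] vertex_cycle_subset_verts[OF assms] assms C
    by (auto simp: vertex_cycle_def)
  have "length p = length C" using length_awalk_verts[of c p] p(2) by simp
  moreover have "distinct (tl (awalk_verts c p))" "3 \<le> length C"
    using assms p(2) C by (auto simp: vertex_cycle_def)
  ultimately show ?thesis
    using p(1) by (intro exI[of _ p]) (auto simp: undirected_cycle_def cycle_def)
qed

section \<open>Blocks\<close>

text \<open>Deleting a vertex from a spanning cycle leaves a path through all other vertices;
  further edges do no harm.\<close>

lemma (in graph) hamiltonian_no_cut_vertex:
  assumes C: "vertex_cycle (arcs_ends G) C" and "verts G = set C"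
  shows "connected G" "\<not> cut_vertex G v"
proof -
  have "successively (\<lambda>x y. (x, y) \<in> arcs_ends G) C"
    using C by (auto simp: vertex_cycle_def successively_append_iff)
  moreover have "C \<noteq> []" using C by (auto simp: vertex_cycle_def)
  ultimately show "connected G"
    using assms(2) successively_in_rtrancl[OF _ sym_arcs_ends] by (simp add: connected_iff_rtrancl)
  show "\<not> cut_vertex G v"
  proof
    assume "cut_vertex G v"
    then obtain x y where v: "v \<in> set C" and xy: "x \<in> set C" "y \<in> set C" "x \<noteq> v" "y \<noteq> v"
      and unreach: "\<not> x \<rightarrow>\<^sup>*\<^bsub>del_vert v\<^esub> y"
      by (auto simp: cut_vertex_def assms(2))
    obtain i where i: "i < length C" "v = C ! i" using v by (auto simp: in_set_conv_nth)
    define C' where "C' = rotate i C"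
    have C': "vertex_cycle (arcs_ends G) C'"
      using C by (simp add: C'_def vertex_cycle_rotate)
    have "C \<noteq> []" using i by auto
    then have "C' \<noteq> []" "hd C' = v"
      using i by (simp_all add: C'_def hd_rotate_conv_nth)
    then obtain T where T: "C' = v # T" by (cases C') auto
    let ?R = "{(a, b) \<in> arcs_ends G. a \<noteq> v \<and> b \<noteq> v}"
    have "v \<notin> set T" using C' T by (simp add: vertex_cycle_def)
    moreover have "successively (\<lambda>x y. (x, y) \<in> arcs_ends G) T"
      using C' T by (auto simp: vertex_cycle_def successively_append_iff successively_Cons)
    ultimately have "successively (\<lambda>x y. (x, y) \<in> ?R) T"
      by (auto elim: successively_mono)
    moreover have "sym ?R" using sym_arcs_ends by (auto simp: sym_def)
    moreover have "set C' = set C" by (simp add: C'_def)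
    then have "x \<in> set T" "y \<in> set T" using xy T by auto
    ultimately have "(x, y) \<in> ?R\<^sup>*" by (rule successively_in_rtrancl)
    then show False
      using unreach del_vert_reachable_iff xy assms(2) by blast
  qed
qed

text \<open>Since \<open>x\<close> and \<open>y\<close> are joined through \<open>c\<close>,
  separating them by deleting \<open>c\<close> would make \<open>c\<close> a cut vertex. This
  supplies \<open>conn\<close> above.\<close>

lemma (in graph) no_cut_vertexD:
  assumes "\<not> (\<exists>v. cut_vertex G v)" "(c, x) \<in> arcs_ends G" "(c, y) \<in> arcs_ends G"
  shows "(x, y) \<in> {(a, b) \<in> arcs_ends G. a \<noteq> c \<and> b \<noteq> c}\<^sup>*"
proof -
  have verts: "c \<in> verts G" "x \<in> verts G" "y \<in> verts G" "x \<noteq> c" "y \<noteq> c"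
    using assms(2,3) irrefl_arcs_ends by (auto dest: adj_in_verts irreflD)
  have "(x, c) \<in> arcs_ends G" using assms(2) sym_arcs_ends by (meson symD)
  then have "x \<rightarrow>\<^sup>* y" using assms(3) by (meson adj_reachable_trans reachable_adjI)
  then show ?thesis
    using assms(1) verts del_vert_reachable_iff unfolding cut_vertex_def by blast
qed

text \<open>A path from \<open>u\<close> to \<open>w\<close> that avoids \<open>v\<close> closes up
  through \<open>v\<close>.\<close>

lemma (in graph) vertex_cycle_if_two_neighbours:
  assumes "\<not> (\<exists>v. cut_vertex G v)"
    and vu: "(v, u) \<in> arcs_ends G" and vw: "(v, w) \<in> arcs_ends G" and "u \<noteq> w"
  shows "\<exists>C. vertex_cycle (arcs_ends G) C"
proof -
  let ?R = "{(a, b) \<in> arcs_ends G. a \<noteq> v \<and> b \<noteq> v}"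
  have "(u, w) \<in> ?R\<^sup>*" using no_cut_vertexD assms by blast
  then obtain W s where W: "s \<in> {w}" "set W \<inter> {w} = {}" "distinct W"
    "successively (\<lambda>x y. (x, y) \<in> ?R) (W @ [s])" "hd (W @ [s]) = u"
    using singletonI by (rule rtrancl_first_hit)
  have "W \<noteq> []" using W \<open>u \<noteq> w\<close> by auto
  have "v \<noteq> w" using vw irrefl_arcs_ends by (auto dest: irreflD)
  have "v \<notin> set W"
  proof
    assume "v \<in> set W"
    then obtain U V where "W = U @ v # V" by (meson split_list)
    then show False using W(4) by (auto simp: successively_append_iff successively_Cons)
  qed
  have "successively (\<lambda>x y. (x, y) \<in> arcs_ends G) (W @ [w])"
    using W by (auto elim: successively_mono)
  moreover have "(w, v) \<in> arcs_ends G" using vw sym_arcs_ends by (meson symD)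
  moreover have "3 \<le> length (v # W @ [w])" using \<open>W \<noteq> []\<close> by (cases W) auto
  ultimately have "vertex_cycle (arcs_ends G) (v # W @ [w])"
    using W vu \<open>W \<noteq> []\<close> \<open>v \<noteq> w\<close> \<open>v \<notin> set W\<close>
    by (auto simp: vertex_cycle_def successively_append_iff successively_Cons)
  then show ?thesis ..
qed

text \<open>By \<open>odd_cycle_edges\<close>, every edge at a vertex of \<open>C\<close> is an edge
  of \<open>C\<close>. Hence no walk leaves \<open>C\<close>, and connectedness makes
  \<open>C\<close> spanning.\<close>

lemma (in graph) odd_cycles_imp_cycle_graph:
  assumes "connected G" "\<not> (\<exists>v. cut_vertex G v)" and C: "vertex_cycle (arcs_ends G) C"
    and odd: "\<And>vs. vertex_cycle (arcs_ends G) vs \<Longrightarrow> odd (length vs)"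
  shows "cycle_graph (length C) G"
proof -
  let ?n = "length C"
  have C': "distinct C" "3 \<le> ?n" using C by (auto simp: vertex_cycle_def)
  have edge: "\<exists>i < ?n. {c, w} = {C ! i, C ! (Suc i mod ?n)}"
    if "c \<in> set C" "(c, w) \<in> arcs_ends G" for c w
    using odd_cycle_edges[OF sym_arcs_ends irrefl_arcs_ends C odd no_cut_vertexD[OF assms(2)] that] .
  have closed: "w \<in> set C" if cw: "c \<in> set C" "(c, w) \<in> arcs_ends G" for c w
  proof -
    obtain i where "i < ?n" "{c, w} = {C ! i, C ! (Suc i mod ?n)}" using edge[OF cw] by blast
    moreover have "Suc i mod ?n < ?n" using C'(2) by (intro mod_less_divisor) linarith
    ultimately have "{c, w} \<subseteq> set C" by simp
    then show ?thesis by simp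
  qed
  have "set C \<subseteq> verts G" by (rule vertex_cycle_subset_verts[OF C])
  moreover have "verts G \<subseteq> set C"
  proof
    fix x assume x: "x \<in> verts G"
    have hd: "hd C \<in> set C" using C' by (intro hd_in_set) auto
    then have "(hd C, x) \<in> (arcs_ends G)\<^sup>*"
      using x assms(1) \<open>set C \<subseteq> verts G\<close> by (auto simp: connected_iff_rtrancl)
    then show "x \<in> set C" by induction (use hd closed in auto)
  qed
  ultimately have verts: "set C = verts G" ..
  have "arcs_ends G = {(u, v). \<exists>i < ?n. {u, v} = {C ! i, C ! (Suc i mod ?n)}}"
    using edge adj_in_verts vertex_cycle_nth[OF C] symD[OF sym_arcs_ends vertex_cycle_nth[OF C]]
    by (auto simp: verts doubleton_eq_iff)
  then show ?thesis
    using C' verts graph_axioms unfolding cycle_graph_def by blast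
qed

text \<open>Describes blocks without cycles: a walk from \<open>x\<close> can only alternate between
  \<open>x\<close> and its single neighbour, if there is one.\<close>

lemma (in graph) at_most_one_neighbour:
  assumes "connected G" and unique: "\<And>v u w. (v, u) \<in> arcs_ends G \<Longrightarrow> (v, w) \<in> arcs_ends G \<Longrightarrow> u = w"
  obtains x where "verts G = {x}" | x y where "(x, y) \<in> arcs_ends G" "verts G = {x, y}"
proof -
  obtain x where x: "x \<in> verts G" using assms(1) by (auto simp: connected_iff_rtrancl)
  have reach: "(x, z) \<in> (arcs_ends G)\<^sup>*" if "z \<in> verts G" for z
    using that x assms(1) by (auto simp: connected_iff_rtrancl)
  show ?thesis
  proof (cases "\<exists>y. (x, y) \<in> arcs_ends G")
    case True
    then obtain y where xy: "(x, y) \<in> arcs_ends G" by blast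
    then have yx: "(y, x) \<in> arcs_ends G" using sym_arcs_ends by (meson symD)
    have "z \<in> {x, y}" if "(x, z) \<in> (arcs_ends G)\<^sup>*" for z
      using that by induction (use unique xy yx in blast)+
    then have "verts G = {x, y}" using reach x xy by (auto dest: adj_in_verts)
    then show ?thesis using that(2) xy by blast
  next
    case False
    then have "verts G = {x}" using reach x by (blast elim: converse_rtranclE)
    then show ?thesis by (rule that(1))
  qed
qed

lemma subgraph_arcs_ends: "subgraph H G \<Longrightarrow> arcs_ends H \<subseteq> arcs_ends G"
  by (auto simp: subgraph_def compatible_def arcs_ends_conv)

text \<open>The cardinality bound excludes the one-vertex graph, which is its own block. Otherwise a
  block without a cycle fits into one edge of \<open>G\<close>, and a cycle through that edge
  contradicts maximality.\<close>

lemma (in graph) block_contains_cycle: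
  assumes "connected G" "\<And>v. v \<in> verts G \<Longrightarrow> even (out_degree G v)" "2 \<le> card (verts G)"
    and block: "block G B"
  shows "\<exists>C. vertex_cycle (arcs_ends B) C"
proof (rule ccontr)
  assume contr: "\<not> ?thesis"
  have B: "subgraph B G" "graph B" "connected B" "\<not> (\<exists>v. cut_vertex B v)"
    and max: "\<And>H. subgraph B H \<Longrightarrow> subgraph H G \<Longrightarrow> graph H \<Longrightarrow> connected H \<Longrightarrow>
      \<not> (\<exists>v. cut_vertex H v) \<Longrightarrow> H = B"
    using block by (auto simp: block_def max_subgraph_def)
  interpret B: graph B by (rule B(2))
  have "\<And>v u w. (v, u) \<in> arcs_ends B \<Longrightarrow> (v, w) \<in> arcs_ends B \<Longrightarrow> u = w"
    using B.vertex_cycle_if_two_neighbours[OF B(4)] contr by blast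
  then obtain x y where xy: "(x, y) \<in> arcs_ends G" and sub: "verts B \<subseteq> {x, y}"
  proof (rule B.at_most_one_neighbour[OF B(3)])
    fix x assume thesis: "\<And>x y. (x, y) \<in> arcs_ends G \<Longrightarrow> verts B \<subseteq> {x, y} \<Longrightarrow> thesis"
      and x: "verts B = {x}"
    then have "x \<in> verts G" using B(1) by (auto simp: subgraph_def)
    moreover have "\<not> verts G \<subseteq> {x}"
      using assms(3) card_mono[of "{x}" "verts G"] by auto
    \<comment> \<open>The first step of a walk from \<open>x\<close> to another vertex gives an edge
      at \<open>x\<close>.\<close>
    ultimately obtain z where "z \<noteq> x" "(x, z) \<in> (arcs_ends G)\<^sup>*"
      using assms(1) by (auto simp: connected_iff_rtrancl)
    then obtain y where "(x, y) \<in> arcs_ends G" by (metis converse_rtranclE)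
    then show thesis using thesis x by blast
  next
    fix x y assume thesis: "\<And>x y. (x, y) \<in> arcs_ends G \<Longrightarrow> verts B \<subseteq> {x, y} \<Longrightarrow> thesis"
      and xy: "(x, y) \<in> arcs_ends B" "verts B = {x, y}"
    show thesis
      by (rule thesis[of x y]) (use subgraph_arcs_ends[OF B(1)] xy in auto)
  qed
  have "finite (arcs_ends G)" by (simp add: arcs_ends_conv)
  \<comment> \<open>Even degree is required at every element of the type; outside the graph the
    neighbourhood is empty.\<close>
  moreover have "even (card (arcs_ends G `` {v}))" for v
  proof (cases "v \<in> verts G")
    case False
    then have "arcs_ends G `` {v} = {}" by (auto dest: adj_in_verts)
    then show ?thesis by simp
  qed (simp add: card_arcs_ends_Image assms(2))
  ultimately obtain C where C: "vertex_cycle (arcs_ends G) C" "x \<in> set C" "y \<in> set C"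
    using edge_in_vertex_cycle[OF _ sym_arcs_ends irrefl_arcs_ends _ xy] by metis
  \<comment> \<open>Taking the induced subgraph makes it contain \<open>B\<close> as soon as the
    vertices of \<open>B\<close> lie on \<open>C\<close>.\<close>
  let ?H = "G \<restriction> set C"
  have CG: "set C \<subseteq> verts G" by (rule vertex_cycle_subset_verts[OF C(1)])
  interpret H: graph ?H by (rule graph_induce_subgraph[OF CG])
  have "hd C \<in> set C" using C(2) by (intro hd_in_set) auto
  then have "vertex_cycle (arcs_ends ?H) C"
    using C(1) unfolding vertex_cycle_def arcs_ends_induce_subgraph
    by (auto elim!: successively_mono)
  then have "connected ?H" "\<And>v. \<not> cut_vertex ?H v"
    using H.hamiltonian_no_cut_vertex by auto
  moreover have "subgraph B ?H"
    using B(1) sub C(2,3) B.wf_digraph H.wf_digraph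
    by (auto simp: subgraph_def compatible_def dest: B.tail_in_verts B.head_in_verts)
  ultimately have "?H = B"
    using max subgraph_induce_subgraphI[OF CG] H.graph_axioms by blast
  \<comment> \<open>Equality would squeeze the at least three vertices of \<open>C\<close> into
    two.\<close>
  then have "set C \<subseteq> {x, y}" using sub by (metis induce_subgraph_verts)
  then have "card (set C) \<le> card {x, y}" by (intro card_mono) auto
  also have "\<dots> \<le> 2" by (simp add: card_insert_if)
  finally show False using C(1) by (simp add: vertex_cycle_def distinct_card)
qed

theorem theorem8:
  fixes G :: "('a,'b) pre_digraph"
  assumes "G \<in> epsilon1"
    and "2 \<le> card (verts G)"
  shows "\<forall>B. block G B \<longrightarrow> (\<exists>n. n mod 4 = 1 \<and> cycle_graph n B)"
proof (intro allI impI)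
  fix B assume block: "block G B"
  have G: "graph G" "connected G" "\<And>v. v \<in> verts G \<Longrightarrow> even (out_degree G v)"
    and len: "\<And>p. undirected_cycle G p \<Longrightarrow> length p mod 4 = 1"
    using assms(1) by (auto simp: epsilon1_def euler_graph_def)
  interpret G: graph G by (rule G(1))
  have B: "subgraph B G" "graph B" "connected B" "\<not> (\<exists>v. cut_vertex B v)"
    using block by (auto simp: block_def G.max_subgraph_def)
  interpret B: graph B by (rule B(2))
  have cycle_len: "length vs mod 4 = 1" if "vertex_cycle (arcs_ends B) vs" for vs
    using vertex_cycle_mono[OF that subgraph_arcs_ends[OF B(1)]]
      G.undirected_cycle_of_vertex_cycle len by metis
  obtain C where C: "vertex_cycle (arcs_ends B) C"
    using G.block_contains_cycle[OF G(2,3) assms(2) block] by blast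
  \<comment> \<open>The shape of \<open>B\<close> follows from parity alone; the residue modulo 4 is
    then read off from \<open>C\<close>.\<close>
  have "odd (length vs)" if "vertex_cycle (arcs_ends B) vs" for vs
    using cycle_len[OF that] by presburger
  then have "cycle_graph (length C) B"
    using B.odd_cycles_imp_cycle_graph B C by blast
  then show "\<exists>n. n mod 4 = 1 \<and> cycle_graph n B" using cycle_len[OF C] by blast
qed

end
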